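(* Let $\rho$ be a left-c.e. semi-measure. Then $X\in2^\omega$ is weakly 2-random for $\rho$ (i.e., $X\in\mathsf{W2R}_\rho$) if and only if $X$ is blindly weakly 2-random for $\overline\rho$.
   Context: $2^{<\omega}$ is the set of finite binary strings, $\varepsilon$ the empty string, $[\![\sigma]\!]=\{X\in2^\omega:\sigma\preceq X\}$, $[\![S]\!]=\bigcup_{\sigma\in S}[\![\sigma]\!]$. A semi-measure is $\rho:2^{<\omega}\to[0,1]$ with $\rho(\varepsilon)=1$ and $\rho(\sigma)\ge\rho(\sigma0)+\rho(\sigma1)$; left-c.e. means its values are uniformly approximable from below by computable non-decreasing rational sequences. For $E\subseteq2^{<\omega}$, $\rho(E)=\sum_{\sigma\in E}\rho(\sigma)$. $X\in\mathsf{W2R}_\rho$ iff $X\notin\bigcap_i[\![U_i]\!]$ for every uniformly c.e. sequence $(U_i)$ of subsets of $2^{<\omega}$ with $\lim_i\rho(U_i)=0$. $\overline\rho(\sigma)=\inf_{n\ge|\sigma|}\sum_{\tau\succeq\sigma,\,|\tau|=n}\rho(\tau)$, which determines a Borel measure $\overline\rho$ on $2^\omega$ (of total mass possibly less than 1). $X$ is blindly weakly 2-random for $\overline\rho$ iff $X\notin\bigcap_i\mathcal U_i$ for every uniformly effectively open (uniformly $\Sigma^0_1$) sequence $(\mathcal U_i)$ of subsets of $2^\omega$ with $\lim_i\overline\rho(\mathcal U_i)=0$. *)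

theory Defs
  imports "HOL-Probability.Probability"
begin

datatype recf = Zr | Sc | Proj nat | Comp recf "recf list" | Prim recf recf | Mn recf

inductive reval :: "recf \<Rightarrow> nat list \<Rightarrow> nat \<Rightarrow> bool" where
  reval_Z: "reval Zr xs 0"
| reval_S: "reval Sc (x # xs) (Suc x)"
| reval_Proj: "i < length xs \<Longrightarrow> reval (Proj i) xs (xs ! i)"
| reval_Comp: "length ys = length gs \<Longrightarrow> (\<forall>i<length gs. reval (gs ! i) xs (ys ! i))
               \<Longrightarrow> reval f ys z \<Longrightarrow> reval (Comp f gs) xs z"
| reval_Prim0: "reval f xs y \<Longrightarrow> reval (Prim f g) (0 # xs) y"
| reval_PrimS: "reval (Prim f g) (n # xs) y \<Longrightarrow> reval g (n # y # xs) z
               \<Longrightarrow> reval (Prim f g) (Suc n # xs) z"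
| reval_Mn: "reval f (n # xs) 0 \<Longrightarrow> (\<forall>m<n. \<exists>y. reval f (m # xs) y \<and> y > 0)
               \<Longrightarrow> reval (Mn f) xs n"

definition computable2 :: "(nat \<Rightarrow> nat \<Rightarrow> nat) \<Rightarrow> bool" where
  "computable2 g \<longleftrightarrow> (\<exists>f. \<forall>x y. reval f [x, y] (g x y))"

text \<open>Finite binary strings are \<open>bool list\<close>; the empty string is \<open>[]\<close>;
  elements of Cantor space are \<open>nat \<Rightarrow> bool\<close>.  A fixed computable bijective coding
  of strings by natural numbers:\<close>
fun str_code :: "bool list \<Rightarrow> nat" where
  "str_code [] = 0"
| "str_code (b # s) = 2 * str_code s + (if b then 2 else 1)"

definition str_prefix_seq :: "bool list \<Rightarrow> (nat \<Rightarrow> bool) \<Rightarrow> bool" where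
  "str_prefix_seq \<sigma> X \<longleftrightarrow> (\<forall>i<length \<sigma>. X i = \<sigma> ! i)"

definition cyl :: "bool list \<Rightarrow> (nat \<Rightarrow> bool) set" where
  "cyl \<sigma> = {X. str_prefix_seq \<sigma> X}"

definition cylset :: "bool list set \<Rightarrow> (nat \<Rightarrow> bool) set" where
  "cylset S = (\<Union>\<sigma>\<in>S. cyl \<sigma>)"

definition unif_ce :: "(nat \<Rightarrow> bool list set) \<Rightarrow> bool" where
  "unif_ce U \<longleftrightarrow> (\<exists>f. \<forall>i \<sigma>. \<sigma> \<in> U i \<longleftrightarrow> (\<exists>y. reval f [i, str_code \<sigma>] y))"

definition unif_eff_open :: "(nat \<Rightarrow> (nat \<Rightarrow> bool) set) \<Rightarrow> bool" where
  "unif_eff_open \<U> \<longleftrightarrow> (\<exists>W. unif_ce W \<and> (\<forall>i. \<U> i = cylset (W i)))"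

definition computable_rat_fun :: "(bool list \<Rightarrow> nat \<Rightarrow> real) \<Rightarrow> bool" where
  "computable_rat_fun q \<longleftrightarrow> (\<exists>p m d. computable2 p \<and> computable2 m \<and> computable2 d \<and>
     (\<forall>\<sigma> s. q \<sigma> s = (real (p (str_code \<sigma>) s) - real (m (str_code \<sigma>) s))
                        / (real (d (str_code \<sigma>) s) + 1)))"

definition semimeasure :: "(bool list \<Rightarrow> real) \<Rightarrow> bool" where
  "semimeasure \<rho> \<longleftrightarrow> (\<forall>\<sigma>. 0 \<le> \<rho> \<sigma> \<and> \<rho> \<sigma> \<le> 1) \<and> \<rho> [] = 1 \<and>
     (\<forall>\<sigma>. \<rho> (\<sigma> @ [False]) + \<rho> (\<sigma> @ [True]) \<le> \<rho> \<sigma>)"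

definition left_ce :: "(bool list \<Rightarrow> real) \<Rightarrow> bool" where
  "left_ce \<rho> \<longleftrightarrow> (\<exists>q. computable_rat_fun q \<and> (\<forall>\<sigma>. incseq (q \<sigma>) \<and> q \<sigma> \<longlonglongrightarrow> \<rho> \<sigma>))"

definition left_ce_semimeasure :: "(bool list \<Rightarrow> real) \<Rightarrow> bool" where
  "left_ce_semimeasure \<rho> \<longleftrightarrow> semimeasure \<rho> \<and> left_ce \<rho>"

definition sm_set :: "(bool list \<Rightarrow> real) \<Rightarrow> bool list set \<Rightarrow> ennreal" where
  "sm_set \<rho> E = (\<integral>\<^sup>+ \<sigma>. ennreal (\<rho> \<sigma>) \<partial>count_space E)"

definition W2R :: "(bool list \<Rightarrow> real) \<Rightarrow> (nat \<Rightarrow> bool) \<Rightarrow> bool" where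
  "W2R \<rho> X \<longleftrightarrow> (\<forall>U. unif_ce U \<and> (\<lambda>i. sm_set \<rho> (U i)) \<longlonglongrightarrow> 0
                    \<longrightarrow> X \<notin> (\<Inter>i. cylset (U i)))"

definition rho_bar :: "(bool list \<Rightarrow> real) \<Rightarrow> bool list \<Rightarrow> real" where
  "rho_bar \<rho> \<sigma> = (INF n\<in>{length \<sigma>..}. \<Sum>\<tau>\<in>{\<tau>. length \<tau> = n \<and> prefix \<sigma> \<tau>}. \<rho> \<tau>)"

text \<open>The Borel measure on Cantor space determined by \<open>\<rho>bar\<close>: the measure on the
  \<sigma>-algebra generated by the cylinders (= the Borel sets) giving each cylinder
  \<open>\<lbrakk>\<sigma>\<rbrakk>\<close> mass \<open>\<rho>bar(\<sigma>)\<close> (unique when it exists).\<close>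
definition rho_bar_measure :: "(bool list \<Rightarrow> real) \<Rightarrow> (nat \<Rightarrow> bool) measure" where
  "rho_bar_measure \<rho> = (SOME M. space M = UNIV \<and> sets M = sigma_sets UNIV (range cyl) \<and>
                             (\<forall>\<sigma>. emeasure M (cyl \<sigma>) = ennreal (rho_bar \<rho> \<sigma>)))"

definition blind_W2R :: "(bool list \<Rightarrow> real) \<Rightarrow> (nat \<Rightarrow> bool) \<Rightarrow> bool" where
  "blind_W2R \<rho> X \<longleftrightarrow> (\<forall>\<U>. unif_eff_open \<U> \<and>
                          (\<lambda>i. emeasure (rho_bar_measure \<rho>) (\<U> i)) \<longlonglongrightarrow> 0
                          \<longrightarrow> X \<notin> (\<Inter>i. \<U> i))"

end

theory Submission
  imports Defs
begin

text \<open>Write \<open>\<rho>bar\<close> for \<open>rho_bar \<rho>\<close>. Since \<open>\<rho>bar \<le> \<rho>\<close>, countable subadditivity turns every test for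
  \<open>\<rho>\<close> into a test for \<open>\<rho>bar\<close>. Conversely, \<open>\<rho> - \<rho>bar\<close> is itself superadditive along the tree of
  strings, so its sum over a prefix-free set of strings of length at least \<open>n\<close> is at most its sum
  over level \<open>n\<close>, and the latter tends to \<open>0\<close> by the definition of \<open>\<rho>bar\<close>. Hence if each effectively
  open \<open>\<U> n\<close> is presented by a uniformly c.e. prefix-free set \<open>V n\<close> of strings longer than \<open>n\<close>,
  then \<open>\<rho>(V n)\<close> exceeds \<open>\<rho>bar(\<U> n)\<close> by a null sequence only.\<close>

section \<open>Recursive functions of fixed arity\<close>

definition recursive_on :: "nat \<Rightarrow> (nat list \<Rightarrow> nat) \<Rightarrow> bool" where
  "recursive_on k F \<longleftrightarrow> (\<exists>f. \<forall>xs. length xs = k \<longrightarrow> reval f xs (F xs))"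

definition recursive_vec :: "nat \<Rightarrow> nat \<Rightarrow> (nat list \<Rightarrow> nat list) \<Rightarrow> bool" where
  "recursive_vec k m T \<longleftrightarrow>
     (\<forall>xs. length xs = k \<longrightarrow> length (T xs) = m) \<and> (\<forall>i<m. recursive_on k (\<lambda>xs. T xs ! i))"

abbreviation decidable_on :: "nat \<Rightarrow> (nat list \<Rightarrow> bool) \<Rightarrow> bool" where
  "decidable_on k P \<equiv> recursive_on k (\<lambda>xs. of_bool (P xs))"

named_theorems recursive_intros

lemma recursive_on_cong:
  assumes "recursive_on k F" "\<And>xs. length xs = k \<Longrightarrow> F xs = G xs"
  shows "recursive_on k G"
  using assms unfolding recursive_on_def by metis

lemma recursive_on_comp:
  assumes "recursive_on m F" "recursive_vec k m T"
  shows "recursive_on k (\<lambda>xs. F (T xs))"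
proof -
  obtain f where f: "\<And>ys. length ys = m \<Longrightarrow> reval f ys (F ys)"
    using assms(1) unfolding recursive_on_def by blast
  obtain g where g: "\<And>i xs. i < m \<Longrightarrow> length xs = k \<Longrightarrow> reval (g i) xs (T xs ! i)"
    using assms(2) unfolding recursive_on_def recursive_vec_def by metis
  have "reval (Comp f (map g [0..<m])) xs (F (T xs))" if "length xs = k" for xs
    using assms(2) that f g by (intro reval_Comp[of "T xs"]) (auto simp: recursive_vec_def)
  thus ?thesis unfolding recursive_on_def by blast
qed

lemma recursive_on_Suc [recursive_intros]:
  assumes "recursive_on k F"
  shows "recursive_on k (\<lambda>xs. Suc (F xs))"
proof -
  have "recursive_on 1 (\<lambda>ys. Suc (hd ys))"
    unfolding recursive_on_def
    by (rule exI[of _ Sc]) (auto simp: length_Suc_conv intro: reval_S)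
  from recursive_on_comp[OF this, of k "\<lambda>xs. [F xs]"] assms show ?thesis
    by (simp add: recursive_vec_def)
qed

lemma recursive_on_const [recursive_intros]: "recursive_on k (\<lambda>xs. c)"
proof (induction c)
  case 0
  show ?case unfolding recursive_on_def using reval_Z by blast
qed (rule recursive_on_Suc)

lemma recursive_vec_id [recursive_intros]: "recursive_vec k k (\<lambda>xs. xs)"
  unfolding recursive_vec_def recursive_on_def by (metis reval_Proj)

lemma recursive_vec_Nil [recursive_intros]: "recursive_vec k 0 (\<lambda>xs. [])"
  by (simp add: recursive_vec_def)

lemma recursive_vec_Cons [recursive_intros]:
  assumes "recursive_on k F" "recursive_vec k m T"
  shows "recursive_vec k (Suc m) (\<lambda>xs. F xs # T xs)"
  using assms unfolding recursive_vec_def by (auto simp: less_Suc_eq_0_disj)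

lemma recursive_vec_tl [recursive_intros]:
  assumes "recursive_vec k m T"
  shows "recursive_vec k (m - 1) (\<lambda>xs. tl (T xs))"
proof -
  have "recursive_on k (\<lambda>xs. tl (T xs) ! i)" if "i < m - 1" for i
    by (rule recursive_on_cong[of k "\<lambda>xs. T xs ! Suc i"])
       (use assms that in \<open>auto simp: recursive_vec_def nth_tl\<close>)
  thus ?thesis using assms by (simp add: recursive_vec_def)
qed

lemma recursive_vec_map [recursive_intros]:
  assumes "\<And>g. g \<in> set gs \<Longrightarrow> recursive_on k (H g)"
  shows "recursive_vec k (length gs) (\<lambda>xs. map (\<lambda>g. H g xs) gs)"
  using assms by (auto simp: recursive_vec_def)

text \<open>Off the end of a list, \<open>hd\<close> and \<open>nth\<close> return values that depend on its length only, hence constants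
  at a fixed arity.\<close>
lemma recursive_on_hd [recursive_intros]:
  assumes "recursive_vec k m T"
  shows "recursive_on k (\<lambda>xs. hd (T xs))"
proof (cases m)
  case 0
  show ?thesis
    by (rule recursive_on_cong[OF recursive_on_const[of k "hd []"]])
       (use assms 0 in \<open>auto simp: recursive_vec_def\<close>)
next
  case (Suc n)
  show ?thesis
    by (rule recursive_on_cong[of k "\<lambda>xs. T xs ! 0"])
       (use assms Suc in \<open>auto simp: recursive_vec_def hd_conv_nth
         simp flip: length_greater_0_conv\<close>)
qed

lemma recursive_on_nth [recursive_intros]:
  assumes "recursive_vec k m T"
  shows "recursive_on k (\<lambda>xs. T xs ! i)"
proof (cases "i < m")
  case True
  with assms show ?thesis by (simp add: recursive_vec_def)
next
  case False
  have "T xs ! i = [] ! (i - m)" if "length xs = k" for xs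
    using assms False that nth_append[of "T xs" "[]" i] by (simp add: recursive_vec_def)
  thus ?thesis by (intro recursive_on_cong[OF recursive_on_const[of k "[] ! (i - m)"]]) simp
qed

lemma recursive_on_length [recursive_intros]:
  assumes "recursive_vec k m T"
  shows "recursive_on k (\<lambda>xs. length (T xs))"
  by (rule recursive_on_cong[OF recursive_on_const[of k m]])
     (use assms in \<open>auto simp: recursive_vec_def\<close>)

lemma recursive_on_comp_Cons:
  assumes "recursive_on (Suc m) (\<lambda>ys. F (hd ys) (tl ys))" "recursive_on k G" "recursive_vec k m T"
  shows "recursive_on k (\<lambda>xs. F (G xs) (T xs))"
  using recursive_on_comp[OF assms(1) recursive_vec_Cons[OF assms(2,3)]] by simp

lemma recursive_on_comp2:
  assumes "recursive_on 2 (\<lambda>ys. F (hd ys) (hd (tl ys)))" "recursive_on k G" "recursive_on k H"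
  shows "recursive_on k (\<lambda>xs. F (G xs) (H xs))"
  using recursive_on_comp_Cons[of 1 "\<lambda>y ys. F y (hd ys)" k G "\<lambda>xs. [H xs]"] assms
  by (simp add: recursive_vec_def numeral_2_eq_2)

lemma recursive_on_rec_nat [recursive_intros]:
  assumes F: "recursive_on k F"
    and G: "recursive_on (Suc (Suc k)) (\<lambda>ys. G (hd ys) (hd (tl ys)) (tl (tl ys)))"
    and N: "recursive_on k N"
  shows "recursive_on k (\<lambda>xs. rec_nat (F xs) (\<lambda>m r. G m r xs) (N xs))"
proof -
  obtain f where f: "\<And>xs. length xs = k \<Longrightarrow> reval f xs (F xs)"
    using F unfolding recursive_on_def by blast
  obtain g where "\<And>ys. length ys = Suc (Suc k) \<Longrightarrow> reval g ys (G (hd ys) (hd (tl ys)) (tl (tl ys)))"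
    using G unfolding recursive_on_def by blast
  hence g: "reval g (m # r # xs) (G m r xs)" if "length xs = k" for m r xs
    using that by (metis length_Cons list.sel(1,3))
  have "reval (Prim f g) (n # xs) (rec_nat (F xs) (\<lambda>m r. G m r xs) n)" if "length xs = k" for n xs
    using that by (induction n) (auto intro: reval_Prim0 reval_PrimS f g)
  hence "recursive_on (Suc k) (\<lambda>ys. rec_nat (F (tl ys)) (\<lambda>m r. G m r (tl ys)) (hd ys))"
    unfolding recursive_on_def by (intro exI[of _ "Prim f g"]) (auto simp: length_Suc_conv)
  from recursive_on_comp_Cons[OF this N recursive_vec_id] show ?thesis .
qed

lemma recursive_on_add [recursive_intros]:
  assumes "recursive_on k F" "recursive_on k G"
  shows "recursive_on k (\<lambda>xs. F xs + G xs)"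
proof -
  have "rec_nat a (\<lambda>_ r. Suc r) n = a + n" for a n :: nat
    by (induction n) auto
  moreover have "recursive_on k (\<lambda>xs. rec_nat (F xs) (\<lambda>_ r. Suc r) (G xs))"
    by (rule recursive_intros assms)+
  ultimately show ?thesis by simp
qed

lemma recursive_on_diff [recursive_intros]:
  assumes "recursive_on k F" "recursive_on k G"
  shows "recursive_on k (\<lambda>xs. F xs - G xs)"
proof -
  have pred: "rec_nat 0 (\<lambda>m _. m) n = n - 1" for n :: nat
    by (cases n) auto
  have "rec_nat a (\<lambda>_ r. rec_nat 0 (\<lambda>m _. m) r) n = a - n" for a n :: nat
    by (induction n) (auto simp: pred)
  moreover have "recursive_on k (\<lambda>xs. rec_nat (F xs) (\<lambda>_ r. rec_nat 0 (\<lambda>m _. m) r) (G xs))"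
    by (rule recursive_intros assms)+
  ultimately show ?thesis by simp
qed

lemma recursive_on_sum [recursive_intros]:
  assumes "recursive_on (Suc k) (\<lambda>ys. F (hd ys) (tl ys))" "recursive_on k N"
  shows "recursive_on k (\<lambda>xs. \<Sum>l<N xs. F l xs)"
proof -
  have tl_tl: "recursive_vec (Suc (Suc k)) k (\<lambda>ys. tl (tl ys))"
    using recursive_vec_tl[OF recursive_vec_tl[OF recursive_vec_id, of "Suc (Suc k)"]] by simp
  have "rec_nat 0 (\<lambda>m r. r + h m) n = (\<Sum>l<n. h l)" for n and h :: "nat \<Rightarrow> nat"
    by (induction n) auto
  moreover have "recursive_on k (\<lambda>xs. rec_nat 0 (\<lambda>m r. r + F m xs) (N xs))"
    by (rule recursive_intros assms(2) recursive_on_comp_Cons[OF assms(1) _ tl_tl])+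
  ultimately show ?thesis by simp
qed

lemma recursive_on_mult [recursive_intros]:
  assumes "recursive_on k F" "recursive_on k G"
  shows "recursive_on k (\<lambda>xs. F xs * G xs)"
proof -
  have "recursive_vec (Suc k) k tl"
    using recursive_vec_tl[OF recursive_vec_id, of "Suc k"] by simp
  with assms(2) have "recursive_on (Suc k) (\<lambda>ys. G (tl ys))"
    by (rule recursive_on_comp)
  from recursive_on_sum[OF this assms(1)] show ?thesis by simp
qed

lemma recursive_on_div_2 [recursive_intros]:
  assumes "recursive_on k F"
  shows "recursive_on k (\<lambda>xs. F xs div 2)"
proof -
  have "rec_nat 0 (\<lambda>m r. m - r) n = n div 2" for n :: nat
    by (induction n) auto
  moreover have "recursive_on k (\<lambda>xs. rec_nat 0 (\<lambda>m r. m - r) (F xs))"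
    by (rule recursive_intros assms)+
  ultimately show ?thesis by simp
qed

lemma recursive_on_power_2 [recursive_intros]:
  assumes "recursive_on k F"
  shows "recursive_on k (\<lambda>xs. 2 ^ F xs)"
proof -
  have "rec_nat 1 (\<lambda>_ r. r + r) n = (2::nat) ^ n" for n
    by (induction n) auto
  moreover have "recursive_on k (\<lambda>xs. rec_nat 1 (\<lambda>_ r. r + r) (F xs))"
    by (rule recursive_intros assms)+
  ultimately show ?thesis by simp
qed

lemma decidable_on_pos [recursive_intros]:
  assumes "recursive_on k F"
  shows "decidable_on k (\<lambda>xs. 0 < F xs)"
proof -
  have "rec_nat 0 (\<lambda>_ _. 1) n = (of_bool (0 < n) :: nat)" for n :: nat
    by (cases n) auto
  moreover have "recursive_on k (\<lambda>xs. rec_nat 0 (\<lambda>_ _. 1) (F xs))"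
    by (rule recursive_intros assms)+
  ultimately show ?thesis by simp
qed

lemma decidable_on_less [recursive_intros]:
  assumes "recursive_on k F" "recursive_on k G"
  shows "decidable_on k (\<lambda>xs. F xs < G xs)"
  using decidable_on_pos[OF recursive_on_diff[OF assms(2,1)]] by simp

lemma decidable_on_not [recursive_intros]:
  assumes "decidable_on k P"
  shows "decidable_on k (\<lambda>xs. \<not> P xs)"
  by (rule recursive_on_cong[OF recursive_on_diff[OF recursive_on_const[of k 1] assms]]) auto

lemma decidable_on_conj [recursive_intros]:
  assumes "decidable_on k P" "decidable_on k Q"
  shows "decidable_on k (\<lambda>xs. P xs \<and> Q xs)"
  by (rule recursive_on_cong[OF recursive_on_mult[OF assms]]) auto

lemma decidable_on_eq [recursive_intros]:
  assumes "recursive_on k F" "recursive_on k G"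
  shows "decidable_on k (\<lambda>xs. F xs = G xs)"
proof -
  have "decidable_on k (\<lambda>xs. \<not> F xs < G xs \<and> \<not> G xs < F xs)"
    by (rule recursive_intros assms)+
  thus ?thesis by (rule recursive_on_cong) auto
qed

lemma decidable_on_ex_less [recursive_intros]:
  assumes "decidable_on (Suc k) (\<lambda>ys. P (hd ys) (tl ys))" "recursive_on k N"
  shows "decidable_on k (\<lambda>xs. \<exists>l<N xs. P l xs)"
proof -
  have "decidable_on k (\<lambda>xs. 0 < (\<Sum>l<N xs. of_bool (P l xs) :: nat))"
    by (rule recursive_intros assms)+
  moreover have "0 < (\<Sum>l<N xs. of_bool (P l xs) :: nat) \<longleftrightarrow> (\<exists>l<N xs. P l xs)" for xs
    by (subst zero_less_iff_neq_zero, subst sum_eq_0_iff) auto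
  ultimately show ?thesis by (simp only:)
qed

lemma decidable_on_all_less [recursive_intros]:
  assumes "decidable_on (Suc k) (\<lambda>ys. P (hd ys) (tl ys))" "recursive_on k N"
  shows "decidable_on k (\<lambda>xs. \<forall>l<N xs. P l xs)"
proof -
  have "decidable_on k (\<lambda>xs. \<not> (\<exists>l<N xs. \<not> P l xs))"
    by (rule recursive_intros assms)+
  thus ?thesis by simp
qed

lemma decidable_on_ball_set [recursive_intros]:
  assumes "\<And>g. g \<in> set gs \<Longrightarrow> decidable_on k (P g)"
  shows "decidable_on k (\<lambda>xs. \<forall>g\<in>set gs. P g xs)"
  using assms
proof (induction gs)
  case Nil
  show ?case by (simp add: recursive_on_const)
next
  case (Cons g gs)
  thus ?case using decidable_on_conj[of k "P g"] by simp
qed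

lemma recursive_on_if [recursive_intros]:
  assumes "decidable_on k P" "recursive_on k F" "recursive_on k G"
  shows "recursive_on k (\<lambda>xs. if P xs then F xs else G xs)"
proof -
  have "recursive_on k (\<lambda>xs. of_bool (P xs) * F xs + of_bool (\<not> P xs) * G xs)"
    by (rule recursive_intros assms)+
  thus ?thesis by (rule recursive_on_cong) auto
qed

section \<open>Stage-bounded evaluation\<close>

text \<open>The result \<open>0\<close> means that no value has been found by stage \<open>s\<close>, and \<open>Suc y\<close> that the value
  is \<open>y\<close>. In the sum for \<open>Mn\<close>, at most one summand is nonzero.\<close>
fun beval :: "recf \<Rightarrow> nat \<Rightarrow> nat list \<Rightarrow> nat" where
  "beval Zr s xs = 1"
| "beval Sc s xs = (if 0 < length xs then Suc (Suc (hd xs)) else 0)"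
| "beval (Proj i) s xs = (if i < length xs then Suc (xs ! i) else 0)"
| "beval (Comp f gs) s xs =
     (if \<forall>g\<in>set gs. 0 < beval g s xs then beval f s (map (\<lambda>g. beval g s xs - 1) gs) else 0)"
| "beval (Prim f g) s xs =
     (if 0 < length xs
      then rec_nat (beval f s (tl xs))
             (\<lambda>m r. if 0 < r then beval g s (m # (r - 1) # tl xs) else 0) (hd xs)
      else 0)"
| "beval (Mn f) s xs =
     (\<Sum>n<s. if beval f s (n # xs) = 1 \<and> (\<forall>m<n. 1 < beval f s (m # xs)) then Suc n else 0)"

lemma beval_Comp_eq_Suc_iff:
  "beval (Comp f gs) s xs = Suc z \<longleftrightarrow>
     (\<exists>ys. list_all2 (\<lambda>g y. beval g s xs = Suc y) gs ys \<and> beval f s ys = Suc z)"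
  (is "?L \<longleftrightarrow> ?R")
proof
  assume ?L
  hence "\<forall>g\<in>set gs. 0 < beval g s xs" "beval f s (map (\<lambda>g. beval g s xs - 1) gs) = Suc z"
    by (auto split: if_splits)
  thus ?R by (intro exI[of _ "map (\<lambda>g. beval g s xs - 1) gs"])
    (auto simp: list.rel_map intro!: list.rel_refl_strong)
next
  assume ?R
  then obtain ys where ys: "list_all2 (\<lambda>g y. beval g s xs = Suc y) gs ys" "beval f s ys = Suc z"
    by blast
  have "map (\<lambda>g. beval g s xs - 1) gs = ys \<and> (\<forall>g\<in>set gs. 0 < beval g s xs)"
    using ys(1) by (induction rule: list_all2_induct) auto
  with ys(2) show ?L by simp
qed

lemma beval_Prim_0: "beval (Prim f g) s (0 # xs) = beval f s xs"
  by simp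

lemma beval_Prim_Suc_eq_Suc_iff:
  "beval (Prim f g) s (Suc n # xs) = Suc z \<longleftrightarrow>
     (\<exists>y. beval (Prim f g) s (n # xs) = Suc y \<and> beval g s (n # y # xs) = Suc z)"
proof -
  have "beval (Prim f g) s (Suc n # xs) =
      (if 0 < beval (Prim f g) s (n # xs)
       then beval g s (n # (beval (Prim f g) s (n # xs) - 1) # xs) else 0)"
    unfolding beval.simps list.sel by simp
  thus ?thesis by (cases "beval (Prim f g) s (n # xs)") (auto simp del: beval.simps)
qed

lemma beval_Mn_eq_Suc_iff:
  "beval (Mn f) s xs = Suc n \<longleftrightarrow>
     n < s \<and> beval f s (n # xs) = Suc 0 \<and> (\<forall>m<n. \<exists>y. beval f s (m # xs) = Suc (Suc y))"
proof -
  define halts where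
    "halts n \<longleftrightarrow> beval f s (n # xs) = 1 \<and> (\<forall>m<n. 1 < beval f s (m # xs))" for n
  have unique: "a = b" if "halts a" "halts b" for a b
    using that unfolding halts_def by (metis less_irrefl linorder_neqE_nat)
  have beval_eq: "beval (Mn f) s xs = (\<Sum>n<s. if halts n then Suc n else 0)"
    by (simp only: beval.simps halts_def)
  have "beval (Mn f) s xs = Suc a" if "a < s" "halts a" for a
  proof -
    have "halts n \<longleftrightarrow> n = a" for n using unique that(2) by blast
    thus ?thesis using that(1) by (simp only: beval_eq) simp
  qed
  moreover have "beval (Mn f) s xs = 0" if "\<not> (\<exists>a<s. halts a)"
    unfolding beval_eq using that by (intro sum.neutral) auto
  ultimately have "beval (Mn f) s xs = Suc n \<longleftrightarrow> n < s \<and> halts n"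
    by (metis nat.distinct(1) nat.inject)
  moreover have "1 < m \<longleftrightarrow> (\<exists>y. m = Suc (Suc y))" for m
    by presburger
  ultimately show ?thesis by (simp add: halts_def del: beval.simps)
qed

declare beval.simps(4-6) [simp del]

lemma beval_induct [consumes 1, case_names Zr Sc Proj Comp Prim_0 Prim_Suc Mn]:
  assumes "beval f s xs = Suc y"
    and closed_Zr: "\<And>xs. P Zr xs 0"
    and closed_Sc: "\<And>x xs. P Sc (x # xs) (Suc x)"
    and closed_Proj: "\<And>i xs. i < length xs \<Longrightarrow> P (Proj i) xs (xs ! i)"
    and closed_Comp: "\<And>f gs xs ys z. list_all2 (\<lambda>g. P g xs) gs ys \<Longrightarrow> P f ys z \<Longrightarrow>
      P (Comp f gs) xs z"
    and closed_Prim_0: "\<And>f g xs y. P f xs y \<Longrightarrow> P (Prim f g) (0 # xs) y"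
    and closed_Prim_Suc: "\<And>f g n xs y z. P (Prim f g) (n # xs) y \<Longrightarrow> P g (n # y # xs) z \<Longrightarrow>
      P (Prim f g) (Suc n # xs) z"
    and closed_Mn: "\<And>f n xs. n < s \<Longrightarrow> P f (n # xs) 0 \<Longrightarrow> \<forall>m<n. \<exists>y. P f (m # xs) (Suc y) \<Longrightarrow>
      P (Mn f) xs n"
  shows "P f xs y"
  using assms(1)
proof (induction f arbitrary: xs y)
  case (Comp f gs)
  then obtain ys where ys: "list_all2 (\<lambda>g y. beval g s xs = Suc y) gs ys" "beval f s ys = Suc y"
    unfolding beval_Comp_eq_Suc_iff by blast
  have "list_all2 (\<lambda>g. P g xs) gs ys"
    using ys(1) by (rule list.rel_mono_strong) (rule Comp.IH(2))
  thus ?case using Comp.IH(1)[OF ys(2)] by (rule closed_Comp)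
next
  case (Prim f g)
  then obtain n zs where xs: "xs = n # zs" by (cases xs) (auto simp: beval.simps)
  have "P (Prim f g) (n # zs) y" if "beval (Prim f g) s (n # zs) = Suc y" for y
    using that
  proof (induction n arbitrary: y)
    case 0
    thus ?case using Prim.IH(1) closed_Prim_0 by (simp add: beval_Prim_0)
  next
    case (Suc n)
    thus ?case using Prim.IH(2) closed_Prim_Suc unfolding beval_Prim_Suc_eq_Suc_iff by blast
  qed
  thus ?case using Prim.prems xs by simp
next
  case (Mn f)
  thus ?case using closed_Mn unfolding beval_Mn_eq_Suc_iff by blast
next
  case Sc
  thus ?case using closed_Sc by (cases xs) auto
qed (use closed_Zr closed_Proj in \<open>auto split: if_splits\<close>)

lemma beval_mono:
  assumes "beval f s xs = Suc y" "s \<le> t"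
  shows "beval f t xs = Suc y"
  using assms(1)
proof (induction rule: beval_induct)
  case (Mn f n xs)
  with assms(2) show ?case by (auto simp: beval_Mn_eq_Suc_iff)
qed (auto simp: beval_Comp_eq_Suc_iff beval_Prim_0 beval_Prim_Suc_eq_Suc_iff)

lemma reval_if_beval: "beval f s xs = Suc y \<Longrightarrow> reval f xs y"
proof (induction rule: beval_induct)
  case (Comp f gs xs ys z)
  thus ?case by (intro reval_Comp[of ys]) (auto simp: list_all2_conv_all_nth)
qed (auto intro: reval_Z reval_S reval_Proj reval_Prim0 reval_PrimS reval_Mn)

lemma ex_uniform_bound_less:
  fixes n :: nat and P :: "nat \<Rightarrow> nat \<Rightarrow> bool"
  assumes "\<And>i. i < n \<Longrightarrow> \<exists>s. P i s" "\<And>i s t. P i s \<Longrightarrow> s \<le> t \<Longrightarrow> P i t"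
  obtains s where "\<And>i. i < n \<Longrightarrow> P i s"
proof -
  obtain s where s: "P i (s i)" if "i < n" for i
    using assms(1) by metis
  have "P i (Max (s ` {..<n}))" if "i < n" for i
    by (rule assms(2)[OF s]) (use that in auto)
  thus ?thesis using that by blast
qed

lemma beval_if_reval: "reval f xs y \<Longrightarrow> \<exists>s. beval f s xs = Suc y"
proof (induction rule: reval.induct)
  case (reval_Comp ys gs xs f z)
  obtain s where s: "beval (gs ! i) s xs = Suc (ys ! i)" if "i < length gs" for i
    using ex_uniform_bound_less[of "length gs" "\<lambda>i s. beval (gs ! i) s xs = Suc (ys ! i)"]
      reval_Comp.IH(1) beval_mono by blast
  obtain t where t: "beval f t ys = Suc z" using reval_Comp by blast
  have "list_all2 (\<lambda>g y. beval g (max s t) xs = Suc y) gs ys"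
    using beval_mono[OF s, of _ "max s t"] reval_Comp.hyps(1) by (auto simp: list_all2_conv_all_nth)
  moreover have "beval f (max s t) ys = Suc z"
    using t by (rule beval_mono) simp
  ultimately show ?case unfolding beval_Comp_eq_Suc_iff by blast
next
  case (reval_PrimS f g n xs y z)
  then obtain s t where "beval (Prim f g) s (n # xs) = Suc y" "beval g t (n # y # xs) = Suc z"
    by blast
  hence "beval (Prim f g) (max s t) (n # xs) = Suc y" "beval g (max s t) (n # y # xs) = Suc z"
    by (auto intro: beval_mono)
  thus ?case unfolding beval_Prim_Suc_eq_Suc_iff by blast
next
  case (reval_Mn f n xs)
  obtain s where s: "\<exists>y. beval f s (m # xs) = Suc (Suc y)" if "m < n" for m
  proof (rule ex_uniform_bound_less[of n "\<lambda>m s. \<exists>y. beval f s (m # xs) = Suc (Suc y)"])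
    show "\<exists>s y. beval f s (m # xs) = Suc (Suc y)" if "m < n" for m
      using reval_Mn.IH(2) that by (metis gr0_implies_Suc)
  qed (blast intro: beval_mono)+
  obtain t where t: "beval f t (n # xs) = Suc 0" using reval_Mn.IH(1) by blast
  define u where "u = max (Suc n) (max s t)"
  have "\<exists>y. beval f u (m # xs) = Suc (Suc y)" if "m < n" for m
    using s[OF that] beval_mono[of f s _ _ u] by (auto simp: u_def)
  moreover have "beval f u (n # xs) = Suc 0"
    using t by (rule beval_mono) (simp add: u_def)
  ultimately have "beval (Mn f) u xs = Suc n"
    unfolding beval_Mn_eq_Suc_iff by (simp add: u_def)
  thus ?case ..
qed (auto simp: beval_Prim_0)

lemma reval_defined_iff: "(\<exists>y. reval f xs y) \<longleftrightarrow> (\<exists>s. 0 < beval f s xs)"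
  using reval_if_beval beval_if_reval by (metis gr0_conv_Suc)

lemma reval_deterministic:
  assumes "reval f xs y" "reval f xs z"
  shows "y = z"
proof -
  obtain s t where "beval f s xs = Suc y" "beval f t xs = Suc z"
    using assms beval_if_reval by blast
  hence "beval f (max s t) xs = Suc y" "beval f (max s t) xs = Suc z"
    by (auto intro: beval_mono)
  thus ?thesis by simp
qed

lemma recursive_on_beval_hd_tl: "recursive_on (Suc k) (\<lambda>ys. beval f (hd ys) (tl ys))"
proof (induction f arbitrary: k)
  case Zr
  show ?case unfolding beval.simps by (rule recursive_intros)+
next
  case Sc
  show ?case unfolding beval.simps by (rule recursive_intros)+
next
  case (Proj i)
  show ?case unfolding beval.simps by (rule recursive_intros)+
next
  case (Comp f gs)
  show ?case unfolding beval.simps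
    by (rule recursive_intros recursive_on_comp_Cons[OF Comp.IH(1)] Comp.IH(2) | assumption)+
next
  case (Prim f g)
  show ?case unfolding beval.simps
    by (rule recursive_intros recursive_on_comp_Cons[OF Prim.IH(1)]
        recursive_on_comp_Cons[OF Prim.IH(2)])+
next
  case (Mn f)
  show ?case unfolding beval.simps
    by (rule recursive_intros recursive_on_comp_Cons[OF Mn.IH])+
qed

lemma recursive_on_beval [recursive_intros]:
  assumes "recursive_on k S" "recursive_vec k m T"
  shows "recursive_on k (\<lambda>xs. beval f (S xs) (T xs))"
  by (rule recursive_on_comp_Cons[OF recursive_on_beval_hd_tl assms])

section \<open>Uniformly decidable families of strings\<close>

definition unif_decidable :: "(nat \<Rightarrow> bool list set) \<Rightarrow> bool" where
  "unif_decidable U \<longleftrightarrow> (\<exists>P. decidable_on 2 (\<lambda>xs. P (hd xs) (hd (tl xs))) \<and>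
     (\<forall>i \<sigma>. \<sigma> \<in> U i \<longleftrightarrow> P i (str_code \<sigma>)))"

lemma unif_decidable_imp_unif_ce:
  assumes "unif_decidable U"
  shows "unif_ce U"
proof -
  obtain P where P: "decidable_on 2 (\<lambda>xs. P (hd xs) (hd (tl xs)))"
    and U: "\<And>i \<sigma>. \<sigma> \<in> U i \<longleftrightarrow> P i (str_code \<sigma>)"
    using assms unfolding unif_decidable_def by blast
  have "decidable_on 3 (\<lambda>ys. \<not> P (hd (tl ys)) (hd (tl (tl ys))))"
    by (rule recursive_intros recursive_on_comp2[OF P])+
  then obtain h where "\<And>ys. length ys = 3 \<Longrightarrow>
      reval h ys (of_bool (\<not> P (hd (tl ys)) (hd (tl (tl ys)))))"
    unfolding recursive_on_def by blast
  hence h: "reval h [n, i, c] (of_bool (\<not> P i c))" for n i c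
    by (metis length_Cons list.sel(1,3) list.size(3) numeral_3_eq_3)
  have "P i c \<longleftrightarrow> (\<exists>y. reval (Mn h) [i, c] y)" for i c
  proof
    assume "P i c"
    with h[of 0 i c] have "reval (Mn h) [i, c] 0" by (intro reval_Mn) auto
    thus "\<exists>y. reval (Mn h) [i, c] y" ..
  next
    assume "\<exists>y. reval (Mn h) [i, c] y"
    then obtain y where "reval h [y, i, c] 0" by (auto elim: reval.cases)
    with h have "of_bool (\<not> P i c) = (0::nat)" by (rule reval_deterministic)
    thus "P i c" by simp
  qed
  thus ?thesis unfolding unif_ce_def using U by blast
qed

definition code_drop :: "nat \<Rightarrow> nat \<Rightarrow> nat" where
  "code_drop l c = rec_nat c (\<lambda>_ r. (r - 1) div 2) l"

definition code_take :: "nat \<Rightarrow> nat \<Rightarrow> nat" where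
  "code_take l c = c - 2 ^ l * code_drop l c"

lemma code_drop_str_code: "code_drop l (str_code \<sigma>) = str_code (drop l \<sigma>)"
proof (induction l)
  case 0
  show ?case by (simp add: code_drop_def)
next
  case (Suc l)
  have "(str_code \<tau> - 1) div 2 = str_code (tl \<tau>)" for \<tau>
    by (cases \<tau>) auto
  with Suc show ?case by (simp add: code_drop_def drop_Suc tl_drop)
qed

lemma str_code_append: "str_code (\<sigma> @ \<tau>) = str_code \<sigma> + 2 ^ length \<sigma> * str_code \<tau>"
  by (induction \<sigma>) auto

lemma code_take_str_code: "code_take l (str_code \<sigma>) = str_code (take l \<sigma>)"
proof (cases "l \<le> length \<sigma>")
  case True
  have "str_code \<sigma> = str_code (take l \<sigma>) + 2 ^ l * str_code (drop l \<sigma>)"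
    using str_code_append[of "take l \<sigma>" "drop l \<sigma>"] True by (simp add: min_absorb2)
  thus ?thesis unfolding code_take_def code_drop_str_code by linarith
next
  case False
  thus ?thesis unfolding code_take_def code_drop_str_code by simp
qed

lemma code_drop_str_code_pos_iff: "0 < code_drop l (str_code \<sigma>) \<longleftrightarrow> l < length \<sigma>"
proof -
  have "0 < str_code \<tau> \<longleftrightarrow> \<tau> \<noteq> []" for \<tau>
    by (cases \<tau>) auto
  thus ?thesis by (simp add: code_drop_str_code not_le)
qed

lemma length_le_str_code: "length \<sigma> \<le> str_code \<sigma>"
  by (induction \<sigma>) auto

lemma recursive_on_code_drop [recursive_intros]:
  assumes "recursive_on k L" "recursive_on k C"
  shows "recursive_on k (\<lambda>xs. code_drop (L xs) (C xs))"
  unfolding code_drop_def by (rule recursive_intros assms)+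

lemma recursive_on_code_take [recursive_intros]:
  assumes "recursive_on k L" "recursive_on k C"
  shows "recursive_on k (\<lambda>xs. code_take (L xs) (C xs))"
  unfolding code_take_def by (rule recursive_intros assms)+

section \<open>Prefix-free presentations of open sets\<close>

definition prefix_free :: "'a list set \<Rightarrow> bool" where
  "prefix_free A \<longleftrightarrow> pairwise parallel A"

definition prefix_minimal :: "'a list set \<Rightarrow> 'a list set" where
  "prefix_minimal S = {\<sigma> \<in> S. \<forall>\<tau>\<in>S. \<not> strict_prefix \<tau> \<sigma>}"

lemma prefix_free_prefix_minimal: "prefix_free (prefix_minimal S)"
  by (auto simp: prefix_free_def prefix_minimal_def pairwise_def strict_prefix_def)

lemma ex_prefix_minimal:
  assumes "\<sigma> \<in> S"
  obtains \<tau> where "\<tau> \<in> prefix_minimal S" "prefix \<tau> \<sigma>"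
proof -
  obtain \<tau> where \<tau>: "\<tau> \<in> S" "prefix \<tau> \<sigma>"
    and least: "\<And>\<mu>. \<mu> \<in> S \<and> prefix \<mu> \<sigma> \<Longrightarrow> length \<tau> \<le> length \<mu>"
    using ex_has_least_nat[of "\<lambda>\<tau>. \<tau> \<in> S \<and> prefix \<tau> \<sigma>" \<sigma> length] assms by auto
  have "\<not> strict_prefix \<mu> \<tau>" if "\<mu> \<in> S" for \<mu>
  proof
    assume "strict_prefix \<mu> \<tau>"
    hence "length \<mu> < length \<tau>" "prefix \<mu> \<tau>"
      by (simp_all add: prefix_length_less strict_prefix_def)
    with least[of \<mu>] that prefix_order.trans[OF _ \<tau>(2), of \<mu>] show False by simp
  qed
  with \<tau> that show ?thesis by (auto simp: prefix_minimal_def)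
qed

lemma prefix_minimal_iff_take:
  "\<sigma> \<in> prefix_minimal S \<longleftrightarrow> \<sigma> \<in> S \<and> (\<forall>l<length \<sigma>. take l \<sigma> \<notin> S)"
proof -
  have "strict_prefix \<tau> \<sigma> \<longleftrightarrow> (\<exists>l<length \<sigma>. \<tau> = take l \<sigma>)" for \<tau>
  proof
    assume "strict_prefix \<tau> \<sigma>"
    thus "\<exists>l<length \<sigma>. \<tau> = take l \<sigma>"
      by (intro exI[of _ "length \<tau>"]) (auto simp: strict_prefix_def prefix_def)
  qed (auto simp: strict_prefix_def take_is_prefix)
  thus ?thesis unfolding prefix_minimal_def by auto
qed

lemma unif_decidable_prefix_minimal:
  assumes "unif_decidable S"
  shows "unif_decidable (\<lambda>i. prefix_minimal (S i))"
proof -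
  obtain P where P: "decidable_on 2 (\<lambda>xs. P (hd xs) (hd (tl xs)))"
    and S: "\<And>i \<sigma>. \<sigma> \<in> S i \<longleftrightarrow> P i (str_code \<sigma>)"
    using assms unfolding unif_decidable_def by blast
  define Q where "Q i c \<longleftrightarrow> P i c \<and> (\<forall>l<c. \<not> (0 < code_drop l c \<and> P i (code_take l c)))" for i c
  have "decidable_on 2 (\<lambda>xs. Q (hd xs) (hd (tl xs)))"
    unfolding Q_def by (rule recursive_intros recursive_on_comp2[OF P])+
  moreover have "\<sigma> \<in> prefix_minimal (S i) \<longleftrightarrow> Q i (str_code \<sigma>)" for i \<sigma>
    using less_le_trans[OF _ length_le_str_code[of \<sigma>]]
    by (auto simp: prefix_minimal_iff_take Q_def S code_drop_str_code_pos_iff code_take_str_code)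
  ultimately show ?thesis unfolding unif_decidable_def by blast
qed

lemma mem_cyl_iff: "X \<in> cyl \<sigma> \<longleftrightarrow> \<sigma> = map X [0..<length \<sigma>]"
  unfolding cyl_def str_prefix_seq_def mem_Collect_eq by (subst list_eq_iff_nth_eq) auto

lemma prefix_map_upt:
  assumes "X \<in> cyl \<sigma>" "length \<sigma> \<le> n"
  shows "prefix \<sigma> (map X [0..<n])"
proof -
  have "\<sigma> = take (length \<sigma>) (map X [0..<n])"
    using assms by (simp add: mem_cyl_iff take_map)
  thus ?thesis by (metis take_is_prefix)
qed

lemma cyl_antimono: "prefix \<sigma> \<tau> \<Longrightarrow> cyl \<tau> \<subseteq> cyl \<sigma>"
  by (auto simp: cyl_def str_prefix_seq_def prefix_def nth_append)

lemma cylset_subset: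
  assumes "\<And>\<sigma>. \<sigma> \<in> S \<Longrightarrow> \<exists>\<tau>\<in>T. prefix \<tau> \<sigma>"
  shows "cylset S \<subseteq> cylset T"
  unfolding cylset_def using assms cyl_antimono by blast

lemma disjoint_family_on_cyl:
  assumes "prefix_free A"
  shows "disjoint_family_on cyl A"
proof -
  have "prefix \<sigma> \<tau> \<or> prefix \<tau> \<sigma>" if "X \<in> cyl \<sigma>" "X \<in> cyl \<tau>" for X \<sigma> \<tau>
    using prefix_map_upt[OF that(1) max.cobounded1] prefix_map_upt[OF that(2) max.cobounded2]
    by (rule prefix_same_cases)
  thus ?thesis
    using assms unfolding disjoint_family_on_def prefix_free_def pairwise_def by blast
qed

lemma cylset_prefix_minimal: "cylset (prefix_minimal S) = cylset S"
proof
  show "cylset (prefix_minimal S) \<subseteq> cylset S"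
    by (auto simp: cylset_def prefix_minimal_def)
  show "cylset S \<subseteq> cylset (prefix_minimal S)"
    by (rule cylset_subset) (meson ex_prefix_minimal)
qed

text \<open>A string \<open>\<sigma>\<close> enters only once a prefix of it has been enumerated by stage \<open>str_code \<sigma>\<close>.
  Membership is then decidable, while the open set is unchanged because every sequence in it has
  arbitrarily long, hence arbitrarily late, initial segments.\<close>
definition late_enumeration :: "(nat \<Rightarrow> bool list set) \<Rightarrow> nat \<Rightarrow> bool list set" where
  "late_enumeration E n = {\<sigma>. n < length \<sigma> \<and> (\<exists>\<tau>\<in>E (str_code \<sigma>). prefix \<tau> \<sigma>)}"

lemma cylset_late_enumeration:
  assumes "incseq E"
  shows "cylset (late_enumeration E n) = cylset (\<Union>s. E s)"
proof
  show "cylset (late_enumeration E n) \<subseteq> cylset (\<Union>s. E s)"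
    by (rule cylset_subset) (auto simp: late_enumeration_def)
  show "cylset (\<Union>s. E s) \<subseteq> cylset (late_enumeration E n)"
  proof
    fix X assume "X \<in> cylset (\<Union>s. E s)"
    then obtain s \<tau> where \<tau>: "\<tau> \<in> E s" "X \<in> cyl \<tau>" unfolding cylset_def by blast
    define \<sigma> where "\<sigma> = map X [0..<Suc (n + s + length \<tau>)]"
    have "s \<le> str_code \<sigma>"
      using length_le_str_code[of \<sigma>] by (simp add: \<sigma>_def)
    with \<tau>(1) have "\<tau> \<in> E (str_code \<sigma>)" using incseqD[OF assms] by blast
    moreover have "prefix \<tau> \<sigma>"
      unfolding \<sigma>_def by (rule prefix_map_upt[OF \<tau>(2)]) simp
    ultimately have "\<sigma> \<in> late_enumeration E n"
      unfolding late_enumeration_def by (auto simp: \<sigma>_def)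
    moreover have "X \<in> cyl \<sigma>" by (simp add: mem_cyl_iff \<sigma>_def)
    ultimately show "X \<in> cylset (late_enumeration E n)" unfolding cylset_def by blast
  qed
qed

lemma unif_decidable_late_enumeration:
  "unif_decidable (\<lambda>i. late_enumeration (\<lambda>s. {\<sigma>. 0 < beval f s [i, str_code \<sigma>]}) i)"
proof -
  define P where
    "P i c \<longleftrightarrow> 0 < code_drop i c \<and> (\<exists>l<Suc c. 0 < beval f c [i, code_take l c])" for i c
  have "decidable_on 2 (\<lambda>xs. P (hd xs) (hd (tl xs)))"
    unfolding P_def by (rule recursive_intros)+
  moreover have "(\<exists>\<tau>\<in>T. prefix \<tau> \<sigma>) \<longleftrightarrow> (\<exists>l<Suc (str_code \<sigma>). take l \<sigma> \<in> T)" for T \<sigma>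
  proof
    assume "\<exists>\<tau>\<in>T. prefix \<tau> \<sigma>"
    then obtain \<tau> where "\<tau> \<in> T" "prefix \<tau> \<sigma>" by blast
    moreover from \<open>prefix \<tau> \<sigma>\<close> have "take (length \<tau>) \<sigma> = \<tau>" by (auto simp: prefix_def)
    moreover from \<open>prefix \<tau> \<sigma>\<close> have "length \<tau> < Suc (str_code \<sigma>)"
      using prefix_length_le length_le_str_code[of \<sigma>] by (metis le_imp_less_Suc le_trans)
    ultimately show "\<exists>l<Suc (str_code \<sigma>). take l \<sigma> \<in> T" by metis
  qed (use take_is_prefix in blast)
  ultimately show ?thesis unfolding unif_decidable_def
    by (intro exI[of _ P])
       (auto simp: P_def late_enumeration_def code_drop_str_code_pos_iff code_take_str_code)
qed

lemma unif_ce_prefix_free_presentation: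
  assumes "unif_ce W"
  obtains V where "unif_ce V" "\<And>i. prefix_free (V i)" "\<And>i \<sigma>. \<sigma> \<in> V i \<Longrightarrow> i < length \<sigma>"
    "\<And>i. cylset (V i) = cylset (W i)"
proof -
  obtain f where f: "\<And>i \<sigma>. \<sigma> \<in> W i \<longleftrightarrow> (\<exists>y. reval f [i, str_code \<sigma>] y)"
    using assms unfolding unif_ce_def by blast
  define E where "E i s = {\<sigma>. 0 < beval f s [i, str_code \<sigma>]}" for i s
  define V where "V i = prefix_minimal (late_enumeration (E i) i)" for i
  have "unif_ce V"
    using unif_decidable_prefix_minimal[OF unif_decidable_late_enumeration]
    unfolding V_def E_def by (rule unif_decidable_imp_unif_ce)
  moreover have "prefix_free (V i)" for i
    unfolding V_def by (rule prefix_free_prefix_minimal)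
  moreover have "i < length \<sigma>" if "\<sigma> \<in> V i" for i \<sigma>
    using that by (simp add: V_def prefix_minimal_def late_enumeration_def)
  moreover have "cylset (V i) = cylset (W i)" for i
  proof -
    have "incseq (E i)"
      unfolding E_def incseq_def by (auto simp: gr0_conv_Suc intro: beval_mono)
    moreover have "(\<Union>s. E i s) = W i"
      by (auto simp: E_def f reval_defined_iff)
    ultimately show ?thesis
      by (simp add: V_def cylset_prefix_minimal cylset_late_enumeration)
  qed
  ultimately show ?thesis by (rule that)
qed

section \<open>Level sums\<close>

definition level_sum :: "(bool list \<Rightarrow> real) \<Rightarrow> bool list \<Rightarrow> nat \<Rightarrow> real" where
  "level_sum \<rho> \<sigma> n = (\<Sum>\<tau> | length \<tau> = n \<and> prefix \<sigma> \<tau>. \<rho> \<tau>)"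

lemma prefix_iff_children:
  fixes \<sigma> \<tau> :: "bool list"
  shows "prefix \<sigma> \<tau> \<longleftrightarrow> \<tau> = \<sigma> \<or> prefix (\<sigma> @ [False]) \<tau> \<or> prefix (\<sigma> @ [True]) \<tau>"
proof
  assume "prefix \<sigma> \<tau>"
  then obtain \<mu> where \<mu>: "\<tau> = \<sigma> @ \<mu>" by (auto simp: prefix_def)
  show "\<tau> = \<sigma> \<or> prefix (\<sigma> @ [False]) \<tau> \<or> prefix (\<sigma> @ [True]) \<tau>"
    by (cases \<mu>; cases "hd \<mu>") (auto simp: \<mu>)
qed (auto simp: prefix_def)

lemma not_prefix_both_children: "prefix (\<sigma> @ [False]) \<tau> \<Longrightarrow> \<not> prefix (\<sigma> @ [True]) \<tau>"
  by (auto simp: prefix_def)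

lemma finite_level: "finite {\<tau> :: bool list. length \<tau> = n \<and> P \<tau>}"
  by (rule finite_subset[OF _ finite_lists_length_eq[of UNIV n]]) auto

lemma level_sum_Nil: "level_sum \<rho> [] n = (\<Sum>\<tau> | length \<tau> = n. \<rho> \<tau>)"
  by (simp add: level_sum_def)

lemma level_sum_self: "level_sum \<rho> \<sigma> (length \<sigma>) = \<rho> \<sigma>"
proof -
  have "{\<tau>. length \<tau> = length \<sigma> \<and> prefix \<sigma> \<tau>} = {\<sigma>}" by (auto simp: prefix_def)
  thus ?thesis by (simp add: level_sum_def)
qed

lemma level_sum_children:
  assumes "length \<sigma> < n"
  shows "level_sum \<rho> \<sigma> n = level_sum \<rho> (\<sigma> @ [False]) n + level_sum \<rho> (\<sigma> @ [True]) n"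
proof -
  have "{\<tau>. length \<tau> = n \<and> prefix \<sigma> \<tau>} =
      {\<tau>. length \<tau> = n \<and> prefix (\<sigma> @ [False]) \<tau>} \<union> {\<tau>. length \<tau> = n \<and> prefix (\<sigma> @ [True]) \<tau>}"
    using assms prefix_iff_children[of \<sigma>] by auto
  thus ?thesis unfolding level_sum_def
    by (simp add: sum.union_disjoint finite_level disjoint_iff not_prefix_both_children)
qed

lemma level_sum_Suc:
  assumes "length \<sigma> \<le> n"
  shows "level_sum \<rho> \<sigma> (Suc n) = level_sum (\<lambda>\<tau>. \<rho> (\<tau> @ [False]) + \<rho> (\<tau> @ [True])) \<sigma> n"
  using assms
proof (induction "n - length \<sigma>" arbitrary: \<sigma>)
  case 0
  hence "n = length \<sigma>" by simp
  thus ?case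
    using level_sum_self[of _ "\<sigma> @ [False]"] level_sum_self[of _ "\<sigma> @ [True]"]
    by (simp add: level_sum_children level_sum_self)
next
  case (Suc k)
  hence "length \<sigma> < n" by simp
  moreover have "level_sum \<rho> (\<sigma> @ [b]) (Suc n)
      = level_sum (\<lambda>\<tau>. \<rho> (\<tau> @ [False]) + \<rho> (\<tau> @ [True])) (\<sigma> @ [b]) n" for b
    using Suc by (intro Suc.hyps(1)) auto
  ultimately show ?case by (simp add: level_sum_children)
qed

section \<open>The measure of an additive function on strings\<close>

locale additive_on_strings =
  fixes \<mu> :: "bool list \<Rightarrow> real"
  assumes nonneg: "0 \<le> \<mu> \<sigma>"
    and additive: "\<mu> \<sigma> = \<mu> (\<sigma> @ [False]) + \<mu> (\<sigma> @ [True])"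
begin

lemma level_sum_eq:
  assumes "length \<sigma> \<le> n"
  shows "level_sum \<mu> \<sigma> n = \<mu> \<sigma>"
  using assms
proof (induction n rule: dec_induct)
  case (step n)
  thus ?case by (simp add: level_sum_Suc additive[symmetric])
qed (rule level_sum_self)

text \<open>Lebesgue measure on the interval from \<open>0\<close> to the total mass is pushed forward along a map
  sending each point to the sequence whose prefixes index the nested half-open intervals
  \<open>string_interval \<sigma>\<close>, of length \<open>\<mu> \<sigma>\<close>, that contain it.\<close>

definition left_end :: "bool list \<Rightarrow> real" where
  "left_end \<sigma> = (\<Sum>i<length \<sigma>. if \<sigma> ! i then \<mu> (take i \<sigma> @ [False]) else 0)"

definition string_interval :: "bool list \<Rightarrow> real set" where
  "string_interval \<sigma> = {left_end \<sigma>..<left_end \<sigma> + \<mu> \<sigma>}"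

primrec descent :: "real \<Rightarrow> nat \<Rightarrow> bool list" where
  "descent t 0 = []"
| "descent t (Suc n) = descent t n @ [left_end (descent t n @ [True]) \<le> t]"

definition descent_seq :: "real \<Rightarrow> nat \<Rightarrow> bool" where
  "descent_seq t n = last (descent t (Suc n))"

lemma descent_eq_map: "descent t n = map (descent_seq t) [0..<n]"
  by (induction n) (auto simp: descent_seq_def)

lemma left_end_snoc:
  "left_end (\<sigma> @ [b]) = left_end \<sigma> + (if b then \<mu> (\<sigma> @ [False]) else 0)"
  by (auto simp: left_end_def nth_append intro!: sum.cong)

lemma mem_string_interval_snoc_iff:
  "t \<in> string_interval (\<sigma> @ [b]) \<longleftrightarrow>
     t \<in> string_interval \<sigma> \<and> b = (left_end (\<sigma> @ [True]) \<le> t)"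
  using additive[of \<sigma>] nonneg[of "\<sigma> @ [False]"] nonneg[of "\<sigma> @ [True]"]
  by (cases b) (auto simp: string_interval_def left_end_snoc)

lemma string_interval_subset: "string_interval \<sigma> \<subseteq> string_interval []"
  by (induction \<sigma> rule: rev_induct) (auto simp: mem_string_interval_snoc_iff)

lemma mem_string_interval_iff:
  assumes "t \<in> string_interval []"
  shows "t \<in> string_interval \<sigma> \<longleftrightarrow> \<sigma> = descent t (length \<sigma>)"
proof (induction \<sigma> rule: rev_induct)
  case Nil
  show ?case using assms by simp
next
  case (snoc b \<sigma>)
  thus ?case by (auto simp: mem_string_interval_snoc_iff)
qed

lemma vimage_descent_seq_cyl:
  "descent_seq -` cyl \<sigma> \<inter> string_interval [] = string_interval \<sigma>"
proof -
  have "descent_seq t \<in> cyl \<sigma> \<longleftrightarrow> t \<in> string_interval \<sigma>" if "t \<in> string_interval []" for t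
    using mem_string_interval_iff[OF that] by (simp add: mem_cyl_iff descent_eq_map)
  thus ?thesis using string_interval_subset by blast
qed

lemma ex_cyl_measure:
  "\<exists>M. space M = UNIV \<and> sets M = sigma_sets UNIV (range cyl) \<and>
     (\<forall>\<sigma>. emeasure M (cyl \<sigma>) = ennreal (\<mu> \<sigma>))"
proof -
  define L where "L = restrict_space lborel (string_interval [])"
  define M where "M = distr L (sigma UNIV (range cyl)) descent_seq"
  have space_L: "space L = string_interval []"
    by (simp add: L_def space_restrict_space)
  have borel: "string_interval \<sigma> \<in> sets lborel" for \<sigma>
    by (simp add: string_interval_def)
  have "string_interval \<sigma> \<in> sets L" for \<sigma>
    unfolding L_def using borel string_interval_subset by (subst sets_restrict_space_iff) auto
  hence measurable: "descent_seq \<in> measurable L (sigma UNIV (range cyl))"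
    by (intro measurable_measure_of) (auto simp: space_L vimage_descent_seq_cyl)
  have "emeasure M (cyl \<sigma>) = ennreal (\<mu> \<sigma>)" for \<sigma>
  proof -
    have "emeasure M (cyl \<sigma>) = emeasure L (string_interval \<sigma>)"
      unfolding M_def
      by (subst emeasure_distr[OF measurable]) (auto simp: space_L vimage_descent_seq_cyl)
    also have "\<dots> = emeasure lborel (string_interval \<sigma>)"
      unfolding L_def using borel string_interval_subset by (intro emeasure_restrict_space) auto
    also have "\<dots> = ennreal (\<mu> \<sigma>)"
      using nonneg by (simp add: string_interval_def)
    finally show ?thesis .
  qed
  moreover have "space M = UNIV" "sets M = sigma_sets UNIV (range cyl)"
    by (simp_all add: M_def)
  ultimately show ?thesis by blast
qed

end

section \<open>Superadditive functions on strings\<close>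

lemma nn_integral_count_space_le:
  fixes f :: "'a \<Rightarrow> ennreal"
  assumes "countable A" "\<And>F. finite F \<Longrightarrow> F \<subseteq> A \<Longrightarrow> sum f F \<le> b"
  shows "(\<integral>\<^sup>+x. f x \<partial>count_space A) \<le> b"
proof (cases "finite A")
  case True
  thus ?thesis using assms(2) by (simp add: nn_integral_count_space_finite)
next
  case False
  define g where "g = from_nat_into A"
  have g: "bij_betw g UNIV A"
    unfolding g_def using assms(1) False by (rule bij_betw_from_nat_into)
  have "(\<Sum>i<n. f (g i)) \<le> b" for n
  proof -
    have "inj_on g {..<n}" using g by (auto simp: bij_betw_def intro: inj_on_subset)
    hence "(\<Sum>i<n. f (g i)) = sum f (g ` {..<n})" by (simp add: sum.reindex)
    also have "\<dots> \<le> b" using g by (intro assms(2)) (auto simp: bij_betw_def)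
    finally show ?thesis .
  qed
  hence "(\<Sum>i. f (g i)) \<le> b" by (intro suminf_le_const) auto
  thus ?thesis
    by (simp add: nn_integral_bij_count_space[OF g, symmetric] nn_integral_count_space_nat)
qed

locale superadditive_on_strings =
  fixes \<rho> :: "bool list \<Rightarrow> real"
  assumes nonneg: "0 \<le> \<rho> \<sigma>"
    and superadditive: "\<rho> (\<sigma> @ [False]) + \<rho> (\<sigma> @ [True]) \<le> \<rho> \<sigma>"
begin

lemma sum_prefix_free_extensions_le:
  assumes "finite A" "prefix_free A" "\<And>\<tau>. \<tau> \<in> A \<Longrightarrow> prefix \<sigma> \<tau>"
  shows "sum \<rho> A \<le> \<rho> \<sigma>"
proof -
  obtain N where "\<forall>\<tau>\<in>A. length \<tau> \<le> N"
    using finite_nat_set_iff_bounded_le[of "length ` A"] assms(1) by auto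
  thus ?thesis using assms
  proof (induction "Suc N - length \<sigma>" arbitrary: \<sigma> A)
    case 0
    hence "A = {}" by (fastforce dest: prefix_length_le)
    thus ?case by (simp add: nonneg)
  next
    case (Suc k)
    show ?case
    proof (cases "\<sigma> \<in> A")
      case True
      hence "A = {\<sigma>}"
        using Suc.prems(3,4) by (auto simp: prefix_free_def pairwise_def)
      thus ?thesis by simp
    next
      case False
      define B where "B b = {\<tau> \<in> A. prefix (\<sigma> @ [b]) \<tau>}" for b
      have "A = B False \<union> B True" "B False \<inter> B True = {}"
        using False Suc.prems(4) prefix_iff_children[of \<sigma>]
        by (auto simp: B_def not_prefix_both_children)
      hence split: "sum \<rho> A = sum \<rho> (B False) + sum \<rho> (B True)"
        using Suc.prems(2) by (metis finite_Un sum.union_disjoint)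
      have child: "sum \<rho> (B b) \<le> \<rho> (\<sigma> @ [b])" for b
        using Suc.hyps(2) Suc.prems
        by (intro Suc.hyps(1)) (auto simp: B_def prefix_free_def pairwise_def)
      show ?thesis
        using split child[of False] child[of True] superadditive[of \<sigma>] by linarith
    qed
  qed
qed

lemma sum_prefix_free_le_level_sum:
  assumes "finite A" "prefix_free A" "\<And>\<tau>. \<tau> \<in> A \<Longrightarrow> n \<le> length \<tau>"
  shows "sum \<rho> A \<le> level_sum \<rho> [] n"
proof -
  have "sum \<rho> A = (\<Sum>\<sigma> | length \<sigma> = n. sum \<rho> {\<tau> \<in> A. take n \<tau> = \<sigma>})"
    using assms finite_level[of n "\<lambda>_. True"] by (intro sum.group[symmetric]) auto
  also have "\<dots> \<le> (\<Sum>\<sigma> | length \<sigma> = n. \<rho> \<sigma>)"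
  proof (intro sum_mono sum_prefix_free_extensions_le)
    fix \<sigma>
    show "prefix_free {\<tau> \<in> A. take n \<tau> = \<sigma>}"
      using assms(2) by (auto simp: prefix_free_def pairwise_def)
  qed (use assms(1) take_is_prefix in auto)
  finally show ?thesis by (simp add: level_sum_Nil)
qed

lemma sm_set_prefix_free_le_level_sum:
  assumes "prefix_free A" "\<And>\<tau>. \<tau> \<in> A \<Longrightarrow> n \<le> length \<tau>"
  shows "sm_set \<rho> A \<le> ennreal (level_sum \<rho> [] n)"
  unfolding sm_set_def
proof (rule nn_integral_count_space_le)
  fix F assume F: "finite F" "F \<subseteq> A"
  have "prefix_free F" using assms(1) F(2) unfolding prefix_free_def by (rule pairwise_subset)
  hence "sum \<rho> F \<le> level_sum \<rho> [] n"
    using F assms(2) by (intro sum_prefix_free_le_level_sum) auto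
  thus "(\<Sum>\<sigma>\<in>F. ennreal (\<rho> \<sigma>)) \<le> ennreal (level_sum \<rho> [] n)"
    by (simp add: sum_ennreal nonneg ennreal_leI)
qed simp

lemma level_sum_nonneg: "0 \<le> level_sum \<rho> \<sigma> n"
  by (auto simp: level_sum_def intro: sum_nonneg nonneg)

lemma level_sum_Suc_le:
  assumes "length \<sigma> \<le> n"
  shows "level_sum \<rho> \<sigma> (Suc n) \<le> level_sum \<rho> \<sigma> n"
  unfolding level_sum_Suc[OF assms] by (auto simp: level_sum_def intro: sum_mono superadditive)

lemma level_sum_tendsto: "(\<lambda>n. level_sum \<rho> \<sigma> n) \<longlonglongrightarrow> rho_bar \<rho> \<sigma>"
proof -
  have "{length \<sigma>..} = range (\<lambda>n. n + length \<sigma>)"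
    by (auto simp: image_iff le_iff_add add.commute)
  hence "rho_bar \<rho> \<sigma> = (INF n. level_sum \<rho> \<sigma> (n + length \<sigma>))"
    by (simp add: rho_bar_def level_sum_def image_image)
  moreover have "bdd_below (range (\<lambda>n. level_sum \<rho> \<sigma> (n + length \<sigma>)))"
    by (rule bdd_belowI2) (rule level_sum_nonneg)
  moreover have "decseq (\<lambda>n. level_sum \<rho> \<sigma> (n + length \<sigma>))"
    by (auto intro!: decseq_SucI level_sum_Suc_le)
  ultimately have "(\<lambda>n. level_sum \<rho> \<sigma> (n + length \<sigma>)) \<longlonglongrightarrow> rho_bar \<rho> \<sigma>"
    using LIMSEQ_decseq_INF by simp
  thus ?thesis by (rule LIMSEQ_offset)
qed

lemma rho_bar_le: "rho_bar \<rho> \<sigma> \<le> \<rho> \<sigma>"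
proof -
  have "level_sum \<rho> \<sigma> n \<le> \<rho> \<sigma>" if "length \<sigma> \<le> n" for n
    using that by (induction rule: dec_induct)
      (auto simp: level_sum_self intro: order_trans[OF level_sum_Suc_le])
  thus ?thesis by (intro LIMSEQ_le_const2[OF level_sum_tendsto]) blast
qed

sublocale rho_bar: additive_on_strings "rho_bar \<rho>"
proof
  fix \<sigma>
  show "0 \<le> rho_bar \<rho> \<sigma>"
    by (rule LIMSEQ_le_const[OF level_sum_tendsto]) (auto intro: level_sum_nonneg)
  have "\<forall>\<^sub>F n in sequentially.
      level_sum \<rho> (\<sigma> @ [False]) n + level_sum \<rho> (\<sigma> @ [True]) n = level_sum \<rho> \<sigma> n"
    using eventually_gt_at_top[of "length \<sigma>"] by eventually_elim (simp add: level_sum_children)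
  with tendsto_add[OF level_sum_tendsto level_sum_tendsto]
  have "(\<lambda>n. level_sum \<rho> \<sigma> n) \<longlonglongrightarrow> rho_bar \<rho> (\<sigma> @ [False]) + rho_bar \<rho> (\<sigma> @ [True])"
    by (rule Lim_transform_eventually)
  with level_sum_tendsto show "rho_bar \<rho> \<sigma> = rho_bar \<rho> (\<sigma> @ [False]) + rho_bar \<rho> (\<sigma> @ [True])"
    by (rule LIMSEQ_unique)
qed

lemma superadditive_diff_rho_bar: "superadditive_on_strings (\<lambda>\<sigma>. \<rho> \<sigma> - rho_bar \<rho> \<sigma>)"
proof
  fix \<sigma>
  show "0 \<le> \<rho> \<sigma> - rho_bar \<rho> \<sigma>" using rho_bar_le by simp
  show "\<rho> (\<sigma> @ [False]) - rho_bar \<rho> (\<sigma> @ [False]) + (\<rho> (\<sigma> @ [True]) - rho_bar \<rho> (\<sigma> @ [True]))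
      \<le> \<rho> \<sigma> - rho_bar \<rho> \<sigma>"
    using superadditive[of \<sigma>] rho_bar.additive[of \<sigma>] by simp
qed

lemma level_sum_diff_rho_bar:
  "level_sum (\<lambda>\<sigma>. \<rho> \<sigma> - rho_bar \<rho> \<sigma>) [] n = level_sum \<rho> [] n - rho_bar \<rho> []"
  using rho_bar.level_sum_eq[of "[]" n] by (simp add: level_sum_def sum_subtractf)

lemma sets_rho_bar_measure: "sets (rho_bar_measure \<rho>) = sigma_sets UNIV (range cyl)"
  and emeasure_rho_bar_cyl: "emeasure (rho_bar_measure \<rho>) (cyl \<sigma>) = ennreal (rho_bar \<rho> \<sigma>)"
  using someI_ex[OF rho_bar.ex_cyl_measure] unfolding rho_bar_measure_def by auto

lemma emeasure_cylset_prefix_free: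
  assumes "prefix_free A"
  shows "emeasure (rho_bar_measure \<rho>) (cylset A) = sm_set (rho_bar \<rho>) A"
  unfolding cylset_def sm_set_def
  by (subst emeasure_UN_countable)
     (auto simp: sets_rho_bar_measure emeasure_rho_bar_cyl disjoint_family_on_cyl[OF assms])

lemma emeasure_cylset_le: "emeasure (rho_bar_measure \<rho>) (cylset U) \<le> sm_set \<rho> U"
proof -
  have "emeasure (rho_bar_measure \<rho>) (cylset U) = sm_set (rho_bar \<rho>) (prefix_minimal U)"
    using emeasure_cylset_prefix_free[OF prefix_free_prefix_minimal, of U]
    by (simp add: cylset_prefix_minimal)
  also have "\<dots> \<le> sm_set \<rho> (prefix_minimal U)"
    unfolding sm_set_def by (intro nn_integral_mono ennreal_leI rho_bar_le)
  also have "\<dots> \<le> sm_set \<rho> U"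
    unfolding sm_set_def
    by (subst (1 2) nn_integral_count_space_indicator)
       (auto simp: prefix_minimal_def indicator_def intro!: nn_integral_mono)
  finally show ?thesis .
qed

lemma sm_set_prefix_free_le_emeasure:
  assumes "prefix_free A" "\<And>\<sigma>. \<sigma> \<in> A \<Longrightarrow> n \<le> length \<sigma>"
  shows "sm_set \<rho> A \<le> emeasure (rho_bar_measure \<rho>) (cylset A)
      + ennreal (level_sum \<rho> [] n - rho_bar \<rho> [])"
proof -
  have "sm_set \<rho> A = sm_set (rho_bar \<rho>) A + sm_set (\<lambda>\<sigma>. \<rho> \<sigma> - rho_bar \<rho> \<sigma>) A"
    by (simp add: sm_set_def nn_integral_add[symmetric] rho_bar_le rho_bar.nonneg
        flip: ennreal_plus)
  also have "sm_set (\<lambda>\<sigma>. \<rho> \<sigma> - rho_bar \<rho> \<sigma>) A \<le> ennreal (level_sum \<rho> [] n - rho_bar \<rho> [])"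
    unfolding level_sum_diff_rho_bar[symmetric]
    by (rule superadditive_on_strings.sm_set_prefix_free_le_level_sum
        [OF superadditive_diff_rho_bar assms])
  finally show ?thesis
    by (simp add: emeasure_cylset_prefix_free[OF assms(1)] add_left_mono)
qed

section \<open>Weak 2-randomness\<close>

lemma blind_W2R_imp_W2R:
  assumes "blind_W2R \<rho> X"
  shows "W2R \<rho> X"
  unfolding W2R_def
proof (intro allI impI, elim conjE)
  fix U assume U: "unif_ce U" "(\<lambda>i. sm_set \<rho> (U i)) \<longlonglongrightarrow> 0"
  have "unif_eff_open (\<lambda>i. cylset (U i))"
    unfolding unif_eff_open_def using U(1) by blast
  moreover have "(\<lambda>i. emeasure (rho_bar_measure \<rho>) (cylset (U i))) \<longlonglongrightarrow> 0"
    by (rule tendsto_sandwich[OF _ _ tendsto_const U(2)]) (auto simp: emeasure_cylset_le)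
  ultimately show "X \<notin> (\<Inter>i. cylset (U i))"
    using assms unfolding blind_W2R_def by blast
qed

lemma W2R_imp_blind_W2R:
  assumes "W2R \<rho> X"
  shows "blind_W2R \<rho> X"
  unfolding blind_W2R_def
proof (intro allI impI, elim conjE)
  fix \<U> assume \<U>: "unif_eff_open \<U>" "(\<lambda>i. emeasure (rho_bar_measure \<rho>) (\<U> i)) \<longlonglongrightarrow> 0"
  obtain W where W: "unif_ce W" "\<And>i. \<U> i = cylset (W i)"
    using \<U>(1) unfolding unif_eff_open_def by blast
  obtain V where V: "unif_ce V" "\<And>i. prefix_free (V i)"
    and long: "\<And>i \<sigma>. \<sigma> \<in> V i \<Longrightarrow> i < length \<sigma>" and cylset_V: "\<And>i. cylset (V i) = \<U> i"
    using unif_ce_prefix_free_presentation[OF W(1)] unfolding W(2) by blast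
  have "(\<lambda>i. ennreal (level_sum \<rho> [] i - rho_bar \<rho> [])) \<longlonglongrightarrow> 0"
    using tendsto_ennrealI[OF LIM_zero[OF level_sum_tendsto]] by simp
  with \<U>(2) have lim: "(\<lambda>i. emeasure (rho_bar_measure \<rho>) (\<U> i)
      + ennreal (level_sum \<rho> [] i - rho_bar \<rho> [])) \<longlonglongrightarrow> 0"
    using tendsto_add by fastforce
  have "sm_set \<rho> (V i) \<le> emeasure (rho_bar_measure \<rho>) (\<U> i)
      + ennreal (level_sum \<rho> [] i - rho_bar \<rho> [])" for i
    using sm_set_prefix_free_le_emeasure[OF V(2) less_imp_le[OF long]] by (simp only: cylset_V)
  hence "(\<lambda>i. sm_set \<rho> (V i)) \<longlonglongrightarrow> 0"
    by (intro tendsto_sandwich[OF _ _ tendsto_const lim]) auto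
  with assms V(1) have "X \<notin> (\<Inter>i. cylset (V i))" unfolding W2R_def by blast
  thus "X \<notin> (\<Inter>i. \<U> i)" by (simp add: cylset_V)
qed

end

theorem theorem6p15:
  fixes \<rho> :: "bool list \<Rightarrow> real" and X :: "nat \<Rightarrow> bool"
  assumes "left_ce_semimeasure \<rho>"
  shows "W2R \<rho> X \<longleftrightarrow> blind_W2R \<rho> X"
proof -
  interpret superadditive_on_strings \<rho>
    using assms by unfold_locales (auto simp: left_ce_semimeasure_def semimeasure_def)
  show ?thesis using W2R_imp_blind_W2R blind_W2R_imp_W2R by blast
qed

end
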